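(* Let $H\subseteq\mathbb{R}^2$ be the set (the Knaster continuum) constructed as follows. For $\alpha\in 2^{\mathbb{N}}$ write $\boldsymbol{\alpha}=\sum_{i=0}^\infty \frac{2\alpha_i}{3^{i+1}}\in[0,1]$, and let $\overline{\alpha}\in 2^{\mathbb{N}}$ be given by $\overline{\alpha}_i=1-\alpha_i$. Let $N_0=2^{\mathbb{N}}$ and, for $k\ge 1$, $N_k=\{\alpha\in 2^{\mathbb{N}}:\min\{i:\alpha_i=1\}=k-1\}$. For $k\ge1$ and $\alpha\in N_k$, let $\widehat{\alpha}\in N_k$ be defined by $\widehat{\alpha}_i=\alpha_i$ for $i\le k-1$ (so $\widehat{\alpha}_i=0$ for $i<k-1$ and $\widehat{\alpha}_{k-1}=1$) and $\widehat{\alpha}_i=1-\alpha_i$ for $i\ge k$. Let $x_0=\frac12$, and for $k\ge1$ let $x_k=\frac{\boldsymbol{\alpha}+\widehat{\boldsymbol{\alpha}}}{2}$ for any $\alpha\in N_k$ (this number does not depend on the choice of $\alpha\in N_k$), where $\widehat{\boldsymbol{\alpha}}$ denotes the real number associated to $\widehat{\alpha}$. Let $H_0$ be the union over $\alpha\in N_0$ of the closed upper semicircles (in $\{y\ge0\}$) centered at $(x_0,0)$ of radius $|x_0-\boldsymbol{\alpha}|$, joining $(\boldsymbol{\alpha},0)$ and $(\overline{\boldsymbol{\alpha}},0)$; for $k\ge1$ let $H_k$ be the union over $\alpha\in N_k$ of the closed lower semicircles (in $\{y\le 0\}$) centered at $(x_k,0)$ of radius $|x_k-\boldsymbol{\alpha}|$,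 joining $(\boldsymbol{\alpha},0)$ and $(\widehat{\boldsymbol{\alpha}},0)$; and let $H=\bigcup_{k\in\mathbb{N}}H_k$. Then the path-connectedness equivalence relation $\approx_H$ on $H$ is Borel bireducible to the equivalence relation $E_0^*$ on $2^{\mathbb{N}}$.
   Context: $2^{\mathbb{N}}$ is the Cantor space with the product topology, and $\mathbb{N}=\{0,1,2,\dots\}$. The equivalence relation $E_0$ on $2^{\mathbb{N}}$ is given by $\alpha E_0\beta$ iff there is $m$ with $\alpha_n=\beta_n$ for all $n\ge m$. The equivalence relation $E_0^*$ on $2^{\mathbb{N}}$ is given by $\alpha E_0^*\beta$ iff $\alpha E_0\beta$ or $\alpha E_0\overline{\beta}$, where $\overline{\beta}_n=1-\beta_n$. For a Polish space $X$ (here $H$ with the subspace topology from $\mathbb{R}^2$), $x\approx_X y$ iff there is a continuous $\gamma:[0,1]\to X$ with $\gamma(0)=x$, $\gamma(1)=y$. For equivalence relations $E$ on $X$ and $F$ on $Y$ (Polish spaces), $E\le_B F$ means there is a Borel map $f:X\to Y$ with $xEy\iff f(x)Ff(y)$; Borel bireducible means $E\le_B F$ and $F\le_B E$. *)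

theory Defs
  imports "HOL-Analysis.Analysis"
begin

text \<open>
  Points of the Cantor space are functions of type \<^typ>\<open>nat \<Rightarrow> bool\<close>, where \<^const>\<open>True\<close> stands for
  the digit 1. The topology of this type is the product of the discrete topologies.
\<close>

type_synonym cantor = "nat \<Rightarrow> bool"

definition compl_seq :: "cantor \<Rightarrow> cantor" where
  "compl_seq \<alpha> = (\<lambda>n. \<not> \<alpha> n)"

definition E0 :: "cantor \<Rightarrow> cantor \<Rightarrow> bool" where
  "E0 \<alpha> \<beta> \<longleftrightarrow> (\<exists>m. \<forall>n\<ge>m. \<alpha> n = \<beta> n)"

definition E0_star :: "cantor \<Rightarrow> cantor \<Rightarrow> bool" where
  "E0_star \<alpha> \<beta> \<longleftrightarrow> E0 \<alpha> \<beta> \<or> E0 \<alpha> (compl_seq \<beta>)"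

text \<open>
  A space is given as a subset of a topological type, with the subspace topology; the Borel sets of
  the subspace are the traces of the ambient Borel sets. Measurability includes that the map sends
  \<open>X\<close> into \<open>Y\<close>.
\<close>

definition borel_reducible ::
  "'a::topological_space set \<Rightarrow> ('a \<Rightarrow> 'a \<Rightarrow> bool) \<Rightarrow>
   'b::topological_space set \<Rightarrow> ('b \<Rightarrow> 'b \<Rightarrow> bool) \<Rightarrow> bool" where
  "borel_reducible X E Y F \<longleftrightarrow>
     (\<exists>f \<in> restrict_space borel X \<rightarrow>\<^sub>M restrict_space borel Y.
        \<forall>x\<in>X. \<forall>y\<in>X. E x y \<longleftrightarrow> F (f x) (f y))"

definition borel_bireducible ::
  "'a::topological_space set \<Rightarrow> ('a \<Rightarrow> 'a \<Rightarrow> bool) \<Rightarrow>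
   'b::topological_space set \<Rightarrow> ('b \<Rightarrow> 'b \<Rightarrow> bool) \<Rightarrow> bool" where
  "borel_bireducible X E Y F \<longleftrightarrow> borel_reducible X E Y F \<and> borel_reducible Y F X E"

definition cantor_real :: "cantor \<Rightarrow> real" where
  "cantor_real \<alpha> = (\<Sum>i. 2 * of_bool (\<alpha> i) / 3 ^ (i + 1))"

definition N :: "nat \<Rightarrow> cantor set" where
  "N k = (if k = 0 then UNIV else {\<alpha>. (\<exists>i. \<alpha> i) \<and> (LEAST i. \<alpha> i) = k - 1})"

definition hat :: "nat \<Rightarrow> cantor \<Rightarrow> cantor" where
  "hat k \<alpha> = (\<lambda>i. if i < k then \<alpha> i else \<not> \<alpha> i)"

text \<open>The description below is justified by \<open>centre_eq\<close>.\<close>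

definition centre :: "nat \<Rightarrow> real" where
  "centre k = (if k = 0 then 1/2
     else (THE x. \<forall>\<alpha>\<in>N k. x = (cantor_real \<alpha> + cantor_real (hat k \<alpha>)) / 2))"

definition upper_semicircle :: "real \<Rightarrow> real \<Rightarrow> (real \<times> real) set" where
  "upper_semicircle c r = {p \<in> sphere (c, 0) r. snd p \<ge> 0}"

definition lower_semicircle :: "real \<Rightarrow> real \<Rightarrow> (real \<times> real) set" where
  "lower_semicircle c r = {p \<in> sphere (c, 0) r. snd p \<le> 0}"

definition H_part :: "nat \<Rightarrow> (real \<times> real) set" where
  "H_part k =
     (if k = 0 then \<Union>\<alpha>\<in>N 0. upper_semicircle (centre 0) \<bar>centre 0 - cantor_real \<alpha>\<bar>
      else \<Union>\<alpha>\<in>N k. lower_semicircle (centre k) \<bar>centre k - cantor_real \<alpha>\<bar>)"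

definition knaster :: "(real \<times> real) set" where
  "knaster = (\<Union>k. H_part k)"

lemma summable_cantor_real: "summable (\<lambda>i. 2 * of_bool (\<alpha> i) / 3 ^ (i + 1) :: real)"
proof (rule summable_comparison_test)
  show "summable (\<lambda>i. (1/3::real) ^ i)" by (rule summable_geometric) simp
  show "\<exists>M. \<forall>i\<ge>M. norm (2 * of_bool (\<alpha> i) / 3 ^ (i + 1) :: real) \<le> (1/3) ^ i"
    by (intro exI[of _ 0] allI impI) (auto simp: of_bool_def power_divide divide_simps)
qed

lemma N_D:
  assumes "\<alpha> \<in> N k" "k \<ge> 1"
  shows "\<alpha> (k - 1)" "i < k - 1 \<Longrightarrow> \<not> \<alpha> i"
proof -
  have ex: "\<exists>i. \<alpha> i" and L: "(LEAST i. \<alpha> i) = k - 1"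
    using assms by (auto simp: N_def)
  show "\<alpha> (k - 1)" using LeastI_ex[OF ex] L by simp
  show "i < k - 1 \<Longrightarrow> \<not> \<alpha> i" using not_less_Least[of i \<alpha>] L by simp
qed

lemma centre_unique:
  assumes "\<alpha> \<in> N k" "\<beta> \<in> N k" "k \<ge> 1"
  shows "cantor_real \<alpha> + cantor_real (hat k \<alpha>) = cantor_real \<beta> + cantor_real (hat k \<beta>)"
proof -
  have agree: "\<alpha> i = \<beta> i" if "i < k" for i
  proof (cases "i = k - 1")
    case True
    then show ?thesis using N_D(1)[OF assms(1,3)] N_D(1)[OF assms(2,3)] by simp
  next
    case False
    then have "i < k - 1" using that by simp
    then show ?thesis using N_D(2)[OF assms(1,3)] N_D(2)[OF assms(2,3)] by simp
  qed
  have "(2 * of_bool (\<alpha> i) / 3 ^ (i + 1) + 2 * of_bool (hat k \<alpha> i) / 3 ^ (i + 1) :: real) =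
        2 * of_bool (\<beta> i) / 3 ^ (i + 1) + 2 * of_bool (hat k \<beta> i) / 3 ^ (i + 1)" for i
    using agree[of i] by (cases "i < k") (auto simp: hat_def)
  then show ?thesis
    unfolding cantor_real_def
    by (simp only: suminf_add[OF summable_cantor_real summable_cantor_real])
qed

lemma centre_eq:
  assumes "\<alpha> \<in> N k" "k \<ge> 1"
  shows "centre k = (cantor_real \<alpha> + cantor_real (hat k \<alpha>)) / 2"
proof -
  have "(THE x. \<forall>\<alpha>\<in>N k. x = (cantor_real \<alpha> + cantor_real (hat k \<alpha>)) / 2) =
        (cantor_real \<alpha> + cantor_real (hat k \<alpha>)) / 2"
  proof (rule the_equality)
    show "\<forall>\<beta>\<in>N k. (cantor_real \<alpha> + cantor_real (hat k \<alpha>)) / 2 =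
            (cantor_real \<beta> + cantor_real (hat k \<beta>)) / 2"
      using centre_unique[OF assms(1) _ assms(2)] by auto
  qed (use assms in blast)
  then show ?thesis using assms(2) by (simp add: centre_def)
qed

end

theory Submission
  imports Defs
begin

text \<open>
  Every semicircle of \<open>H\<close> joins a point \<open>\<alpha>\<close> of the Cantor set on the axis to \<open>hat k \<alpha>\<close>, where the
  upper ones are the case \<open>k = 0\<close>. Going down from \<open>\<alpha>\<close> and then up again changes a prefix \<open>0\<dots>01\<close>
  of \<open>\<alpha>\<close> into \<open>1\<dots>10\<close>, which is a step of the odometer. Hence the axis points of one chain of
  semicircles form exactly one class of \<open>E\<^sub>0\<^sup>*\<close>.

  That no path leaves its chain is seen from continuous maps into the Cantor space, which is totally
  disconnected. Where \<open>y > 0\<close>, the left end of the upper semicircle is such a map. Where \<open>x \<noteq> 1/2\<close>,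
  slide a point with \<open>y \<ge> 0\<close> down to the axis along its semicircle, on its side of \<open>x = 1/2\<close>, and
  then take the left end of the lower semicircle; this remains continuous at the point \<open>(0, 0)\<close>,
  where the lower semicircles accumulate. These two open sets cover \<open>H\<close>, so the class of
  \<open>E\<^sub>0\<^sup>*\<close> is locally constant along paths.
\<close>

section \<open>Maps into products of discrete spaces\<close>

lemma continuous_on_discrete_coordinate:
  fixes g :: "'a::topological_space \<Rightarrow> 'i \<Rightarrow> 'b::discrete_topology"
    and h :: "'b \<Rightarrow> 'c::topological_space"
  assumes "continuous_on S g"
  shows "continuous_on S (\<lambda>x. h (g x i))"
proof (rule continuous_on_compose2[where g = h and t = UNIV])
  show "continuous_on S (\<lambda>x. g x i)"
    using assms by (rule continuous_on_product_then_coordinatewise)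
  show "continuous_on UNIV h"
    by (simp add: continuous_on_open_vimage open_discrete)
qed simp

lemma compact_UNIV_fun: "compact (UNIV :: ('i \<Rightarrow> 'a::{finite, topological_space}) set)"
proof -
  have "compact_space (euclidean :: 'a topology)"
    by (simp add: compact_space_def finite_imp_compact)
  then have "compact_space (product_topology (\<lambda>_::'i. euclidean :: 'a topology) UNIV)"
    by (simp add: compact_space_product_topology)
  then show ?thesis
    by (simp add: euclidean_product_topology compact_space_def)
qed

lemma connected_imp_constant_discrete_fun:
  fixes g :: "'a::topological_space \<Rightarrow> 'i \<Rightarrow> 'b::discrete_topology"
  assumes "connected S" "continuous_on S g" "x \<in> S" "y \<in> S"
  shows "g x = g y"
proof
  fix i
  have "continuous_on S (\<lambda>z. g z i = g y i)"
    using assms(2) by (rule continuous_on_discrete_coordinate)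
  with assms(1) have "\<exists>c. \<forall>z\<in>S. (g z i = g y i) = c"
    by (rule connectedD_const)
  then show "g x i = g y i"
    using assms(3,4) by auto
qed

lemma connected_imp_related:
  fixes R :: "'a::topological_space \<Rightarrow> 'a \<Rightarrow> bool"
  assumes "connected S" "locally connected S" "equivp R" "a \<in> S" "b \<in> S"
    and chart: "\<And>x. x \<in> S \<Longrightarrow> \<exists>V (g :: 'a \<Rightarrow> 'i \<Rightarrow> 'b::discrete_topology).
      openin (top_of_set S) V \<and> x \<in> V \<and> continuous_on V g \<and>
      (\<forall>y\<in>V. \<forall>z\<in>V. g y = g z \<longrightarrow> R y z)"
  shows "R a b"
  using assms(1,4,5)
proof (rule connected_equivalence_relation)
  show "R y x" if "R x y" for x y
    using assms(3) that by (rule equivp_symp)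
  show "R x z" if "R x y" "R y z" for x y z
    using assms(3) that by (rule equivp_transp)
next
  fix x assume "x \<in> S"
  from chart[OF this] obtain V and g :: "'a \<Rightarrow> 'i \<Rightarrow> 'b" where
    V: "openin (top_of_set S) V" "x \<in> V" "continuous_on V g"
    and R: "\<And>y z. y \<in> V \<Longrightarrow> z \<in> V \<Longrightarrow> g y = g z \<Longrightarrow> R y z"
    by blast
  obtain T where T: "openin (top_of_set S) T" "connected T" "x \<in> T" "T \<subseteq> V"
    using assms(2) V(1,2) unfolding locally_connected by blast
  have g: "continuous_on T g"
    using V(3) T(4) by (rule continuous_on_subset)
  have "R x y" if y: "y \<in> T" for y
  proof (rule R)
    show "g x = g y"
      using T(2) g T(3) y by (rule connected_imp_constant_discrete_fun)
  qed (use T(3,4) y in auto)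
  with T(1,3) show "\<exists>T. openin (top_of_set S) T \<and> x \<in> T \<and> (\<forall>y\<in>T. R x y)"
    by blast
qed

lemma path_component_imp_related:
  fixes R :: "'a::topological_space \<Rightarrow> 'a \<Rightarrow> bool"
  assumes "path_component X p q" "equivp R"
    and chart: "\<And>x. x \<in> X \<Longrightarrow> \<exists>W (g :: 'a \<Rightarrow> 'i \<Rightarrow> 'b::discrete_topology).
      open W \<and> x \<in> W \<and> continuous_on (X \<inter> W) g \<and>
      (\<forall>y\<in>X \<inter> W. \<forall>z\<in>X \<inter> W. g y = g z \<longrightarrow> R y z)"
  shows "R p q"
proof -
  obtain \<gamma> where \<gamma>: "continuous_on {0..1::real} \<gamma>" "\<gamma> ` {0..1} \<subseteq> X" "\<gamma> 0 = p" "\<gamma> 1 = q"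
    using assms(1) by (auto simp: path_defs path_component_def)
  have "R (\<gamma> 0) (\<gamma> 1)"
  proof (rule connected_imp_related[where S = "{0..1}" and R = "\<lambda>s t. R (\<gamma> s) (\<gamma> t)"])
    show "equivp (\<lambda>s t. R (\<gamma> s) (\<gamma> t))"
      using equivp_vimage2p[OF assms(2), of \<gamma>] by (simp add: vimage2p_def)
  next
    fix s :: real assume s: "s \<in> {0..1}"
    then have "\<gamma> s \<in> X" using \<gamma>(2) by blast
    from chart[OF this] obtain W and g :: "'a \<Rightarrow> 'i \<Rightarrow> 'b" where
      W: "open W" "\<gamma> s \<in> W" "continuous_on (X \<inter> W) g"
      and R: "\<And>y z. y \<in> X \<inter> W \<Longrightarrow> z \<in> X \<inter> W \<Longrightarrow> g y = g z \<Longrightarrow> R y z"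
      by blast
    let ?V = "{0..1} \<inter> \<gamma> -` W"
    have \<gamma>_V: "\<gamma> t \<in> X \<inter> W" if "t \<in> ?V" for t
      using that \<gamma>(2) by blast
    show "\<exists>V (h :: real \<Rightarrow> 'i \<Rightarrow> 'b). openin (top_of_set {0..1}) V \<and> s \<in> V \<and>
        continuous_on V h \<and> (\<forall>t\<in>V. \<forall>u\<in>V. h t = h u \<longrightarrow> R (\<gamma> t) (\<gamma> u))"
    proof (intro exI conjI ballI impI)
      show "openin (top_of_set {0..1}) ?V"
        using \<gamma>(1) W(1) by (rule continuous_openin_preimage_gen)
      show "continuous_on ?V (\<lambda>t. g (\<gamma> t))"
        using \<gamma>_V
        by (intro continuous_on_compose2[OF W(3)] continuous_on_subset[OF \<gamma>(1)]) auto
    qed (use s W(2) in simp, rule R[OF \<gamma>_V \<gamma>_V])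
  qed (simp_all add: convex_imp_locally_connected)
  then show ?thesis
    using \<gamma>(3,4) by simp
qed

lemma borel_measurable_If_continuous_on:
  assumes "{x. P x} \<in> sets borel"
    and "continuous_on (X \<inter> {x. P x}) f" "continuous_on (X \<inter> {x. \<not> P x}) g"
  shows "(\<lambda>x. if P x then f x else g x) \<in> borel_measurable (restrict_space borel X)"
proof -
  have "{x \<in> space (restrict_space borel X). P x} \<in> sets (restrict_space borel X)"
    using assms(1) by (auto simp: sets_restrict_space space_restrict_space)
  moreover have "h \<in> borel_measurable (restrict_space (restrict_space borel X) A)"
    if "continuous_on (X \<inter> A) h" for h :: "'a \<Rightarrow> 'b" and A
    using borel_measurable_continuous_on_restrict[OF that]
    by (simp cong: measurable_cong_sets add: sets_restrict_restrict_space)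
  ultimately show ?thesis
    using assms(2,3) by (simp add: measurable_If_restrict_space_iff)
qed

section \<open>Generators of \<open>E\<^sub>0\<^sup>*\<close>\<close>

lemma E0_star_iff_eventually:
  "E0_star \<alpha> \<beta> \<longleftrightarrow> (\<exists>b. \<forall>\<^sub>F n in sequentially. (\<alpha> n = \<beta> n) = b)"
  by (auto simp: E0_star_def E0_def compl_seq_def eventually_sequentially ex_bool_eq)

lemma equivp_E0_star: "equivp E0_star"
proof (rule equivpI)
  show "reflp E0_star"
    by (auto simp: reflp_def E0_star_iff_eventually intro: exI[of _ True])
  show "symp E0_star"
    by (simp add: symp_def E0_star_iff_eventually eq_commute)
  show "transp E0_star"
  proof (rule transpI)
    fix \<alpha> \<beta> \<gamma>
    assume "E0_star \<alpha> \<beta>" "E0_star \<beta> \<gamma>"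
    then obtain b c where "\<forall>\<^sub>F n in sequentially. (\<alpha> n = \<beta> n) = b"
      and "\<forall>\<^sub>F n in sequentially. (\<beta> n = \<gamma> n) = c"
      by (auto simp: E0_star_iff_eventually)
    then have "\<forall>\<^sub>F n in sequentially. (\<alpha> n = \<gamma> n) = (b = c)"
      by eventually_elim auto
    then show "E0_star \<alpha> \<gamma>"
      unfolding E0_star_iff_eventually by blast
  qed
qed

lemmas E0_star_refl = equivp_reflp[OF equivp_E0_star]
  and E0_star_sym = equivp_symp[OF equivp_E0_star]
  and E0_star_trans [trans] = equivp_transp[OF equivp_E0_star]

lemma E0_star_hat: "E0_star \<alpha> (hat k \<alpha>)"
proof -
  have "\<forall>\<^sub>F n in sequentially. (\<alpha> n = hat k \<alpha> n) = False"
    by (rule eventually_sequentiallyI[of k]) (simp add: hat_def)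
  then show ?thesis
    unfolding E0_star_iff_eventually by blast
qed

lemma N_0 [simp]: "\<alpha> \<in> N 0"
  by (simp add: N_def)

lemma N_Suc_iff: "\<alpha> \<in> N (Suc n) \<longleftrightarrow> \<alpha> n \<and> (\<forall>i<n. \<not> \<alpha> i)"
proof
  assume "\<alpha> n \<and> (\<forall>i<n. \<not> \<alpha> i)"
  moreover from this have "(LEAST i. \<alpha> i) = n"
    by (intro Least_equality) (auto simp: not_less[symmetric])
  ultimately show "\<alpha> \<in> N (Suc n)"
    by (auto simp: N_def)
qed (use N_D[of \<alpha> "Suc n"] in simp)

lemma hat_in_N: "\<alpha> \<in> N k \<Longrightarrow> hat k \<alpha> \<in> N k"
  by (cases k) (auto simp: N_Suc_iff hat_def)

lemma N_cases:
  obtains (zero) "\<alpha> = (\<lambda>_. False)" | (first_one) k where "k \<ge> 1" "\<alpha> \<in> N k"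
proof (cases "\<exists>i. \<alpha> i")
  case True
  then have "\<alpha> \<in> N (Suc (LEAST i. \<alpha> i))"
    by (simp add: N_def)
  then show ?thesis
    by (rule that(2)[rotated]) simp
qed (use that(1) in auto)

definition joined :: "cantor \<Rightarrow> cantor \<Rightarrow> bool" where
  "joined \<alpha> \<beta> \<longleftrightarrow> (\<exists>k. \<alpha> \<in> N k \<and> \<beta> = hat k \<alpha>)"

lemma equivclp_joined_hat: "\<alpha> \<in> N k \<Longrightarrow> equivclp joined \<alpha> (hat k \<alpha>)"
  by (rule r_into_equivclp) (auto simp: joined_def)

lemma equivclp_joined_odometer:
  assumes "\<alpha> \<in> N k"
  shows "equivclp joined \<alpha> (\<lambda>i. if i < k then \<not> \<alpha> i else \<alpha> i)"
proof -
  have "equivclp joined \<alpha> (hat k \<alpha>)"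
    using assms by (rule equivclp_joined_hat)
  also have "equivclp joined (hat k \<alpha>) (hat 0 (hat k \<alpha>))"
    by (rule equivclp_joined_hat) simp
  also have "hat 0 (hat k \<alpha>) = (\<lambda>i. if i < k then \<not> \<alpha> i else \<alpha> i)"
    by (auto simp: hat_def)
  finally show ?thesis .
qed

lemma equivclp_joined_if_eq_from:
  "\<forall>i\<ge>n. \<alpha> i = \<beta> i \<Longrightarrow> equivclp joined \<alpha> \<beta>"
proof (induction n arbitrary: \<alpha> \<beta>)
  case 0
  then have "\<alpha> = \<beta>" by auto
  then show ?case by simp
next
  case (Suc n)
  have clear_digit: "equivclp joined \<alpha> \<beta>"
    if eq: "\<forall>i\<ge>Suc n. \<alpha> i = \<beta> i" and digit: "\<alpha> n" "\<not> \<beta> n" for \<alpha> \<beta>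
  proof -
    define \<delta> where "\<delta> = (\<lambda>i. n \<le> i \<and> \<alpha> i)"
    have "equivclp joined \<alpha> \<delta>"
      by (rule Suc.IH) (simp add: \<delta>_def)
    also have "equivclp joined \<delta> (\<lambda>i. if i < Suc n then \<not> \<delta> i else \<delta> i)"
      using digit by (intro equivclp_joined_odometer) (simp add: N_Suc_iff \<delta>_def)
    also have "equivclp joined \<dots> \<beta>"
      using eq digit by (intro Suc.IH) (auto simp: \<delta>_def less_Suc_eq)
    finally show ?thesis .
  qed
  consider (equal) "\<forall>i\<ge>n. \<alpha> i = \<beta> i" | (cleared) "\<alpha> n" "\<not> \<beta> n" | (set) "\<beta> n" "\<not> \<alpha> n"
    using Suc.prems by (metis le_antisym not_less_eq_eq)
  then show ?case
  proof cases
    case equal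
    then show ?thesis by (rule Suc.IH)
  next
    case cleared
    with Suc.prems show ?thesis by (rule clear_digit)
  next
    case set
    have "equivclp joined \<beta> \<alpha>"
      using Suc.prems set by (intro clear_digit) auto
    then show ?thesis by (rule equivclp_sym)
  qed
qed

lemma E0_star_eq_equivclp_joined: "E0_star = equivclp joined"
proof (intro ext iffI)
  fix \<alpha> \<beta> assume "E0_star \<alpha> \<beta>"
  then consider (same) n where "\<forall>i\<ge>n. \<alpha> i = \<beta> i" | (flipped) n where "\<forall>i\<ge>n. \<alpha> i = hat 0 \<beta> i"
    unfolding E0_star_def E0_def compl_seq_def hat_def by auto
  then show "equivclp joined \<alpha> \<beta>"
  proof cases
    case (flipped n)
    then have "equivclp joined \<alpha> (hat 0 \<beta>)"
      by (rule equivclp_joined_if_eq_from)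
    also have "equivclp joined (hat 0 \<beta>) \<beta>"
      by (rule equivclp_sym) (simp add: equivclp_joined_hat)
    finally show ?thesis .
  qed (rule equivclp_joined_if_eq_from)
next
  fix \<alpha> \<beta> assume "equivclp joined \<alpha> \<beta>"
  then show "E0_star \<alpha> \<beta>"
  proof (induction rule: equivclp_induct)
    case (step \<beta> \<gamma>)
    then show ?case
      unfolding joined_def using E0_star_hat E0_star_sym E0_star_trans by blast
  qed (rule E0_star_refl)
qed

section \<open>The embedding of the Cantor space into the line\<close>

lemma cantor_real_nonneg: "0 \<le> cantor_real \<alpha>"
  unfolding cantor_real_def by (intro suminf_nonneg summable_cantor_real) auto

lemma sums_two_thirds: "(\<lambda>i. 2 / 3 ^ (i + 1) :: real) sums 1"
proof -
  have "(\<lambda>i. (2/3) * (1/3) ^ i :: real) sums ((2/3) * (1 / (1 - 1/3)))"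
    by (intro sums_mult geometric_sums) simp
  then show ?thesis by (simp add: power_divide field_simps)
qed

lemma cantor_real_hat_0: "cantor_real (hat 0 \<alpha>) = 1 - cantor_real \<alpha>"
proof -
  have "cantor_real \<alpha> + cantor_real (hat 0 \<alpha>) =
      (\<Sum>i. 2 * of_bool (\<alpha> i) / 3 ^ (i + 1) + 2 * of_bool (hat 0 \<alpha> i) / 3 ^ (i + 1))"
    unfolding cantor_real_def by (rule suminf_add[OF summable_cantor_real summable_cantor_real])
  also have "\<dots> = (\<Sum>i. 2 / 3 ^ (i + 1))"
    by (intro suminf_cong) (simp add: hat_def of_bool_def)
  also have "\<dots> = 1"
    using sums_two_thirds by (rule sums_unique[symmetric])
  finally show ?thesis by simp
qed

lemma cantor_real_le_1: "cantor_real \<alpha> \<le> 1"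
  using cantor_real_nonneg[of "hat 0 \<alpha>"] by (simp add: cantor_real_hat_0)

lemma cantor_real_rec:
  "cantor_real \<alpha> = (2 * of_bool (\<alpha> 0) + cantor_real (\<lambda>i. \<alpha> (Suc i))) / 3"
proof -
  have "cantor_real \<alpha> = 2 * of_bool (\<alpha> 0) / 3 + (\<Sum>i. (2 * of_bool (\<alpha> (Suc i)) / 3 ^ (i + 1)) / 3)"
    unfolding cantor_real_def
    using suminf_split_head[OF summable_cantor_real, of \<alpha>] by (simp add: mult.commute)
  also have "(\<Sum>i. (2 * of_bool (\<alpha> (Suc i)) / 3 ^ (i + 1)) / 3) = cantor_real (\<lambda>i. \<alpha> (Suc i)) / 3"
    unfolding cantor_real_def by (rule suminf_divide[OF summable_cantor_real])
  finally show ?thesis by (simp add: add_divide_distrib)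
qed

lemma cantor_real_eq_imp_first_eq:
  assumes "cantor_real \<alpha> = cantor_real \<beta>"
  shows "\<alpha> 0 = \<beta> 0"
  using assms cantor_real_rec[of \<alpha>] cantor_real_rec[of \<beta>]
    cantor_real_nonneg[of "\<lambda>i. \<alpha> (Suc i)"] cantor_real_le_1[of "\<lambda>i. \<alpha> (Suc i)"]
    cantor_real_nonneg[of "\<lambda>i. \<beta> (Suc i)"] cantor_real_le_1[of "\<lambda>i. \<beta> (Suc i)"]
  by (cases "\<alpha> 0"; cases "\<beta> 0") auto

lemma inj_cantor_real: "inj cantor_real"
proof (rule injI, rule ext)
  fix \<alpha> \<beta> n
  assume "cantor_real \<alpha> = cantor_real \<beta>"
  then show "\<alpha> n = \<beta> n"
  proof (induction n arbitrary: \<alpha> \<beta>)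
    case 0
    then show ?case by (rule cantor_real_eq_imp_first_eq)
  next
    case (Suc n)
    then have "\<alpha> 0 = \<beta> 0"
      by (intro cantor_real_eq_imp_first_eq)
    then have "cantor_real (\<lambda>i. \<alpha> (Suc i)) = cantor_real (\<lambda>i. \<beta> (Suc i))"
      using Suc.prems cantor_real_rec[of \<alpha>] cantor_real_rec[of \<beta>] by simp
    then show ?case by (rule Suc.IH)
  qed
qed

lemma continuous_on_cantor_real: "continuous_on UNIV cantor_real"
proof -
  have uniform: "uniform_limit UNIV (\<lambda>n \<alpha>. \<Sum>i<n. 2 * of_bool (\<alpha> i) / 3 ^ (i + 1))
      (\<lambda>\<alpha>. \<Sum>i. 2 * of_bool (\<alpha> i) / 3 ^ (i + 1) :: real) sequentially"
  proof (rule Weierstrass_m_test)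
    show "summable (\<lambda>i. 2 / 3 ^ (i + 1) :: real)"
      using sums_two_thirds by (rule sums_summable)
    show "norm (2 * of_bool (\<alpha> n) / 3 ^ (n + 1) :: real) \<le> 2 / 3 ^ (n + 1)" for n and \<alpha> :: cantor
      by simp
  qed
  have "continuous_on UNIV (\<lambda>\<alpha>. of_bool (\<alpha> i) :: real)" for i :: nat
    by (rule continuous_on_discrete_coordinate[OF continuous_on_id])
  then have partial_sums: "\<forall>\<^sub>F n in sequentially. continuous_on UNIV
      (\<lambda>\<alpha>. \<Sum>i<n. 2 * of_bool (\<alpha> i) / 3 ^ (i + 1) :: real)"
    by (intro always_eventually allI continuous_intros) auto
  show ?thesis
    unfolding cantor_real_def by (rule uniform_limit_theorem[OF partial_sums uniform]) simp
qed

definition cantor_digits :: "real \<Rightarrow> cantor" where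
  "cantor_digits = inv cantor_real"

lemma cantor_digits_cantor_real [simp]: "cantor_digits (cantor_real \<alpha>) = \<alpha>"
  by (simp add: cantor_digits_def inj_cantor_real)

lemma continuous_on_cantor_digits: "continuous_on (range cantor_real) cantor_digits"
  by (rule continuous_on_inv[OF continuous_on_cantor_real compact_UNIV_fun]) simp

lemma cantor_real_N_Suc_bounds:
  "\<alpha> \<in> N (Suc n) \<Longrightarrow> 2 / 3 ^ Suc n \<le> cantor_real \<alpha> \<and> cantor_real \<alpha> \<le> 3 / 3 ^ Suc n"
proof (induction n arbitrary: \<alpha>)
  case 0
  then show ?case
    using cantor_real_rec[of \<alpha>] cantor_real_nonneg[of "\<lambda>i. \<alpha> (Suc i)"] cantor_real_le_1[of \<alpha>]
    by (simp add: N_Suc_iff)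
next
  case (Suc n)
  then have "\<not> \<alpha> 0" "(\<lambda>i. \<alpha> (Suc i)) \<in> N (Suc n)"
    by (auto simp: N_Suc_iff)
  then have "cantor_real \<alpha> = cantor_real (\<lambda>i. \<alpha> (Suc i)) / 3"
    using cantor_real_rec[of \<alpha>] by simp
  with Suc.IH[OF \<open>(\<lambda>i. \<alpha> (Suc i)) \<in> N (Suc n)\<close>] show ?case
    by simp
qed

lemma cantor_real_N_bounds:
  assumes "\<alpha> \<in> N k" "k \<ge> 1"
  shows "2 / 3 ^ k \<le> cantor_real \<alpha>" "cantor_real \<alpha> \<le> 3 / 3 ^ k"
  using assms cantor_real_N_Suc_bounds[of \<alpha> "k - 1"] by simp_all

section \<open>The semicircles\<close>

lemma cantor_real_hat:
  assumes "\<alpha> \<in> N k"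
  shows "cantor_real (hat k \<alpha>) = 2 * centre k - cantor_real \<alpha>"
proof (cases "k = 0")
  case True
  then show ?thesis by (simp add: centre_def cantor_real_hat_0)
next
  case False
  then show ?thesis using centre_eq[of \<alpha> k] assms by simp
qed

lemma centre_nonneg: "0 \<le> centre k"
proof -
  have "(\<lambda>i. i = k - 1) \<in> N k"
    by (cases k) (simp_all add: N_Suc_iff)
  then obtain \<alpha> where "\<alpha> \<in> N k" ..
  then show ?thesis
    using cantor_real_hat[of \<alpha> k] cantor_real_nonneg[of \<alpha>] cantor_real_nonneg[of "hat k \<alpha>"]
    by linarith
qed

abbreviation cantor_point :: "cantor \<Rightarrow> real \<times> real" where
  "cantor_point \<alpha> \<equiv> (cantor_real \<alpha>, 0)"

definition semicircle :: "nat \<Rightarrow> cantor \<Rightarrow> (real \<times> real) set" where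
  "semicircle k \<alpha> =
     (if k = 0 then upper_semicircle else lower_semicircle) (centre k) \<bar>centre k - cantor_real \<alpha>\<bar>"

lemma mem_semicircle_iff:
  "p \<in> semicircle k \<alpha> \<longleftrightarrow>
     dist p (centre k, 0) = \<bar>centre k - cantor_real \<alpha>\<bar> \<and> (if k = 0 then 0 \<le> snd p else snd p \<le> 0)"
  by (auto simp: semicircle_def upper_semicircle_def lower_semicircle_def dist_commute)

lemma H_part_eq: "H_part k = (\<Union>\<alpha>\<in>N k. semicircle k \<alpha>)"
  by (simp add: H_part_def semicircle_def)

lemma mem_knaster_iff: "p \<in> knaster \<longleftrightarrow> (\<exists>k. \<exists>\<alpha>\<in>N k. p \<in> semicircle k \<alpha>)"
  by (simp add: knaster_def H_part_eq)

lemma dist_axis [simp]: "dist (x, 0 :: real) (c, 0) = \<bar>x - c\<bar>"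
  by (simp add: dist_Pair_Pair dist_real_def)

lemma cantor_point_mem_semicircle: "cantor_point \<alpha> \<in> semicircle k \<alpha>"
  by (simp add: mem_semicircle_iff abs_minus_commute)

lemma cantor_point_hat_mem_semicircle:
  "\<alpha> \<in> N k \<Longrightarrow> cantor_point (hat k \<alpha>) \<in> semicircle k \<alpha>"
  by (simp add: mem_semicircle_iff cantor_real_hat)

lemma semicircle_axisE:
  assumes "\<alpha> \<in> N k" "(x, 0) \<in> semicircle k \<alpha>"
  obtains \<beta> where "x = cantor_real \<beta>" "E0_star \<alpha> \<beta>"
proof -
  have "x = cantor_real \<alpha> \<or> x = cantor_real (hat k \<alpha>)"
    using assms by (auto simp: mem_semicircle_iff cantor_real_hat abs_if split: if_splits)
  then show ?thesis
    using that E0_star_refl E0_star_hat by blast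
qed

lemma path_connected_semicircle: "path_connected (semicircle k \<alpha>)"
proof -
  define S where "S = sphere (centre k, 0 :: real) \<bar>centre k - cantor_real \<alpha>\<bar>"
  define fold where
    "fold p = (fst p, if k = 0 then \<bar>snd p\<bar> else - \<bar>snd p\<bar>)" for p :: "real \<times> real"
  have "semicircle k \<alpha> = fold ` S"
  proof
    show "semicircle k \<alpha> \<subseteq> fold ` S"
    proof
      fix p assume "p \<in> semicircle k \<alpha>"
      then have "p = fold p" "p \<in> S"
        by (cases p; auto simp: fold_def S_def mem_semicircle_iff dist_commute split: if_splits)+
      then show "p \<in> fold ` S" by (rule image_eqI)
    qed
    have "dist (fold p) c = dist p c" if "snd c = 0" for p c
      using that by (simp add: fold_def dist_prod_def dist_real_def)
    then show "fold ` S \<subseteq> semicircle k \<alpha>"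
      by (auto simp: S_def mem_semicircle_iff dist_commute) (auto simp: fold_def)
  qed
  moreover have "continuous_on S fold"
    unfolding fold_def by (cases "k = 0") (auto intro!: continuous_intros)
  moreover have "path_connected S"
    by (simp add: S_def path_connected_sphere)
  ultimately show ?thesis
    by (simp add: path_connected_continuous_image)
qed

definition same_semicircle :: "real \<times> real \<Rightarrow> real \<times> real \<Rightarrow> bool" where
  "same_semicircle p q \<longleftrightarrow> (\<exists>k. \<exists>\<alpha>\<in>N k. p \<in> semicircle k \<alpha> \<and> q \<in> semicircle k \<alpha>)"

lemma same_semicircleI:
  "\<alpha> \<in> N k \<Longrightarrow> p \<in> semicircle k \<alpha> \<Longrightarrow> q \<in> semicircle k \<alpha> \<Longrightarrow> same_semicircle p q"
  by (auto simp: same_semicircle_def)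

lemma same_semicircle_refl: "p \<in> knaster \<Longrightarrow> same_semicircle p p"
  by (auto simp: mem_knaster_iff same_semicircle_def)

lemma same_semicircle_imp_knaster: "same_semicircle p q \<Longrightarrow> q \<in> knaster"
  by (auto simp: mem_knaster_iff same_semicircle_def)

lemma cantor_point_mem_knaster: "cantor_point \<alpha> \<in> knaster"
  using cantor_point_mem_semicircle[of \<alpha> 0] by (auto simp: mem_knaster_iff intro: N_0)

lemma knaster_axis: "(x, 0) \<in> knaster \<Longrightarrow> x \<in> range cantor_real"
  by (auto simp: mem_knaster_iff elim: semicircle_axisE)

lemma same_semicircle_imp_path_component:
  assumes "same_semicircle p q"
  shows "path_component knaster p q"
proof -
  obtain k \<alpha> where \<alpha>: "\<alpha> \<in> N k" "p \<in> semicircle k \<alpha>" "q \<in> semicircle k \<alpha>"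
    using assms by (auto simp: same_semicircle_def)
  show ?thesis
  proof (rule path_component_of_subset)
    show "semicircle k \<alpha> \<subseteq> knaster"
      using \<alpha>(1) mem_knaster_iff by blast
    show "path_component (semicircle k \<alpha>) p q"
      using path_connected_semicircle \<alpha>(2,3) by (simp add: path_connected_component)
  qed
qed

lemma E0_star_imp_path_component:
  assumes "E0_star \<alpha> \<beta>"
  shows "path_component knaster (cantor_point \<alpha>) (cantor_point \<beta>)"
  using assms unfolding E0_star_eq_equivclp_joined
proof (induction rule: equivclp_induct)
  case base
  show ?case
    using cantor_point_mem_knaster by (rule path_component_refl)
next
  case (step \<beta> \<gamma>)
  have "path_component knaster (cantor_point \<beta>) (cantor_point \<gamma>)" if "joined \<beta> \<gamma>" for \<beta> \<gamma>
    using that cantor_point_mem_semicircle cantor_point_hat_mem_semicircle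
    by (auto simp: joined_def intro!: same_semicircle_imp_path_component intro: same_semicircleI)
  with step show ?case
    by (meson path_component_sym path_component_trans)
qed

section \<open>The upper and the lower half of the continuum\<close>

definition upper_half :: "(real \<times> real) set" where
  "upper_half = knaster \<inter> {p. 0 \<le> snd p}"

definition lower_half :: "(real \<times> real) set" where
  "lower_half = knaster \<inter> {p. snd p \<le> 0}"

lemma upper_half_cases:
  assumes "p \<in> upper_half"
  obtains \<alpha> where "p \<in> semicircle 0 \<alpha>"
proof (cases "snd p = 0")
  case True
  then obtain \<alpha> where "p = cantor_point \<alpha>"
    using assms knaster_axis[of "fst p"] by (cases p) (auto simp: upper_half_def)
  then show ?thesis
    using that[of \<alpha>] cantor_point_mem_semicircle by simp
next
  case False
  then show ?thesis
    using assms that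
    by (auto simp: upper_half_def mem_knaster_iff mem_semicircle_iff split: if_splits)
qed

lemma lower_half_cases:
  assumes "p \<in> lower_half"
  obtains (origin) "p = (0, 0)" | (arc) k where "k \<ge> 1" "p \<in> H_part k"
proof (cases "snd p = 0")
  case True
  then obtain \<alpha> where p: "p = cantor_point \<alpha>"
    using assms knaster_axis[of "fst p"] by (cases p) (auto simp: lower_half_def)
  show ?thesis
  proof (cases \<alpha> rule: N_cases)
    case zero
    then show ?thesis using origin p by (simp add: cantor_real_def)
  next
    case (first_one k)
    then show ?thesis using arc p cantor_point_mem_semicircle by (auto simp: H_part_eq)
  qed
next
  case False
  then obtain k where "p \<in> H_part k" "k \<noteq> 0"
    using assms by (auto simp: lower_half_def knaster_def H_part_def upper_semicircle_def
        split: if_splits)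
  then show ?thesis
    using arc[of k] by simp
qed

lemma H_part_fst_bounds:
  assumes "k \<ge> 1" "p \<in> H_part k"
  shows "2 / 3 ^ k \<le> fst p" "fst p \<le> 3 / 3 ^ k"
proof -
  obtain \<alpha> where \<alpha>: "\<alpha> \<in> N k" "p \<in> semicircle k \<alpha>"
    using assms(2) by (auto simp: H_part_eq)
  have "\<bar>fst p - centre k\<bar> \<le> dist p (centre k, 0)"
    using dist_fst_le[of p "(centre k, 0)"] by (simp add: dist_real_def)
  also have "\<dots> = \<bar>centre k - cantor_real \<alpha>\<bar>"
    using \<alpha>(2) by (simp add: mem_semicircle_iff)
  finally have "\<bar>fst p - centre k\<bar> \<le> \<bar>centre k - cantor_real \<alpha>\<bar>" .
  then show "2 / 3 ^ k \<le> fst p" "fst p \<le> 3 / 3 ^ k"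
    using cantor_real_N_bounds[OF \<alpha>(1) assms(1)] cantor_real_hat[OF \<alpha>(1)]
      cantor_real_N_bounds[OF hat_in_N[OF \<alpha>(1)] assms(1)]
    by linarith+
qed

text \<open>
  Below and above the part \<open>k\<close>, the next parts end at \<open>3/3\<^sup>k\<^sup>+\<^sup>1 = 1/3\<^sup>k\<close> and begin at
  \<open>2/3\<^sup>k\<^sup>-\<^sup>1 = 6/3\<^sup>k\<close>.
\<close>

lemma H_part_index_eq:
  assumes "j \<ge> 1" "p \<in> H_part j" "1 / 3 ^ k < fst p" "fst p < 6 / 3 ^ k"
  shows "j = k"
proof (rule ccontr)
  assume "j \<noteq> k"
  then consider (greater) "Suc k \<le> j" | (less) "Suc j \<le> k" by linarith
  then show False
  proof cases
    case greater
    then have "(3::real) / 3 ^ j \<le> 3 / 3 ^ Suc k"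
      by (intro divide_left_mono power_increasing) auto
    then show False using H_part_fst_bounds[OF assms(1,2)] assms(3) by simp
  next
    case less
    then have "(6::real) / 3 ^ k \<le> 6 / 3 ^ Suc j"
      by (intro divide_left_mono power_increasing) auto
    then show False using H_part_fst_bounds[OF assms(1,2)] assms(4) by simp
  qed
qed

lemma H_part_fst_strict_bounds:
  assumes "k \<ge> 1" "p \<in> H_part k"
  shows "1 / 3 ^ k < fst p" "fst p < 6 / 3 ^ k"
proof -
  have "(1::real) / 3 ^ k < 2 / 3 ^ k" "(3::real) / 3 ^ k < 6 / 3 ^ k"
    by (intro divide_strict_right_mono; simp)+
  then show "1 / 3 ^ k < fst p" "fst p < 6 / 3 ^ k"
    using H_part_fst_bounds[OF assms] by linarith+
qed

lemma H_part_index_unique: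
  assumes "j \<ge> 1" "k \<ge> 1" "p \<in> H_part j" "p \<in> H_part k"
  shows "j = k"
  using assms(1,3) H_part_fst_strict_bounds[OF assms(2,4)] by (rule H_part_index_eq)

lemma lower_half_fst_neq_half:
  assumes "p \<in> lower_half"
  shows "fst p \<noteq> 1/2"
  using assms
proof (cases rule: lower_half_cases)
  case (arc k)
  show ?thesis
  proof
    assume half: "fst p = 1/2"
    then have "k = 1"
      using H_part_index_eq[OF arc, of 1] by simp
    then show False
      using H_part_fst_bounds(1)[OF arc] half by simp
  qed
qed simp

definition left_foot :: "nat \<Rightarrow> real \<times> real \<Rightarrow> real" where
  "left_foot k p = centre k - dist p (centre k, 0)"

lemma left_foot_mem_semicircle:
  "p \<in> semicircle k \<alpha> \<Longrightarrow> (left_foot k p, 0) \<in> semicircle k \<alpha>"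
  by (simp add: mem_semicircle_iff left_foot_def)

lemma continuous_on_left_foot: "continuous_on S (left_foot k)"
  unfolding left_foot_def by (intro continuous_intros)

lemma abs_left_foot_le: "\<bar>left_foot k p\<bar> \<le> norm p"
  using abs_dist_diff_le[of 0 "(centre k, 0)" p] centre_nonneg[of k]
  by (simp add: left_foot_def norm_Pair dist_commute)

lemma same_semicircle_left_foot_0:
  assumes "p \<in> upper_half"
  shows "same_semicircle p (left_foot 0 p, 0)"
proof -
  obtain \<alpha> where "p \<in> semicircle 0 \<alpha>"
    using assms by (rule upper_half_cases)
  then show ?thesis
    by (intro same_semicircleI[OF N_0] left_foot_mem_semicircle)
qed

text \<open>
  At \<open>(0, 0)\<close> the description below is empty, but \<open>left_foot k (0, 0) = 0\<close> for every \<open>k\<close>.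
\<close>

definition left_end :: "real \<times> real \<Rightarrow> real" where
  "left_end p = left_foot (THE k. k \<ge> 1 \<and> p \<in> H_part k) p"

lemma abs_left_end_le: "\<bar>left_end p\<bar> \<le> norm p"
  unfolding left_end_def by (rule abs_left_foot_le)

lemma left_end_eq_left_foot:
  assumes "k \<ge> 1" "p \<in> H_part k"
  shows "left_end p = left_foot k p"
proof -
  have "(THE j. j \<ge> 1 \<and> p \<in> H_part j) = k"
    using assms H_part_index_unique by (intro the_equality) blast+
  then show ?thesis by (simp add: left_end_def)
qed

lemma same_semicircle_left_end:
  assumes "p \<in> lower_half"
  shows "same_semicircle p (left_end p, 0)"
  using assms
proof (cases rule: lower_half_cases)
  case origin
  then have "(left_end p, 0) = p"
    using abs_left_end_le[of p] by (simp add: zero_prod_def[symmetric])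
  then show ?thesis
    using assms same_semicircle_refl[of p] by (simp add: lower_half_def)
next
  case (arc k)
  then obtain \<alpha> where "\<alpha> \<in> N k" "p \<in> semicircle k \<alpha>"
    by (auto simp: H_part_eq)
  then show ?thesis
    unfolding left_end_eq_left_foot[OF arc]
    by (auto intro: same_semicircleI left_foot_mem_semicircle)
qed

lemma eventually_left_end_eq_left_foot:
  assumes "k \<ge> 1" "p \<in> H_part k"
  shows "\<forall>\<^sub>F q in at p within lower_half. left_end q = left_foot k q"
proof -
  define U :: "(real \<times> real) set" where "U = {1 / 3 ^ k <..< 6 / 3 ^ k} \<times> UNIV"
  have "left_end q = left_foot k q" if q: "q \<in> U" "q \<in> lower_half" for q
    using q(2)
  proof (cases rule: lower_half_cases)
    case origin
    moreover have "0 < (1::real) / 3 ^ k" by simp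
    ultimately show ?thesis using q(1) by (auto simp: U_def)
  next
    case (arc j)
    then have "j = k"
      using q(1) H_part_index_eq by (auto simp: U_def)
    then show ?thesis
      using left_end_eq_left_foot[OF arc] by simp
  qed
  moreover have "open U" "p \<in> U"
    using H_part_fst_strict_bounds[OF assms] by (auto simp: U_def open_Times mem_Times_iff)
  ultimately show ?thesis
    unfolding eventually_at_topological by blast
qed

lemma continuous_on_left_end: "continuous_on lower_half left_end"
  unfolding continuous_on_def
proof
  fix p assume "p \<in> lower_half"
  then show "(left_end \<longlongrightarrow> left_end p) (at p within lower_half)"
  proof (cases rule: lower_half_cases)
    case origin
    then have p: "p = 0" by (simp add: zero_prod_def)
    have "(norm \<longlongrightarrow> 0) (at p within lower_half)"
      using tendsto_norm[OF tendsto_ident_at[of p lower_half]] p by simp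
    then have "(left_end \<longlongrightarrow> 0) (at p within lower_half)"
      by (rule Lim_null_comparison[rotated]) (simp add: abs_left_end_le)
    moreover have "left_end p = 0"
      using abs_left_end_le[of p] p by simp
    ultimately show ?thesis by simp
  next
    case (arc k)
    have "(left_foot k \<longlongrightarrow> left_foot k p) (at p within lower_half)"
      using continuous_on_left_foot \<open>p \<in> lower_half\<close> unfolding continuous_on_def by blast
    then show ?thesis
      using eventually_left_end_eq_left_foot[OF arc] left_end_eq_left_foot[OF arc]
      by (simp add: tendsto_cong)
  qed
qed

text \<open>For \<open>fst p = 1/2\<close> and \<open>snd p > 0\<close> the value is the centre, which is not on the semicircle.\<close>

definition slide :: "real \<times> real \<Rightarrow> real \<times> real" where
  "slide p = (if snd p \<le> 0 then p else (1/2 + sgn (fst p - 1/2) * dist p (1/2, 0), 0))"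

lemma same_semicircle_slide:
  assumes "p \<in> knaster" "fst p \<noteq> 1/2"
  shows "same_semicircle p (slide p)"
proof (cases "snd p \<le> 0")
  case True
  then show ?thesis
    using assms by (simp add: slide_def same_semicircle_refl)
next
  case False
  then obtain \<alpha> where \<alpha>: "p \<in> semicircle 0 \<alpha>"
    using assms upper_half_cases[of p] by (auto simp: upper_half_def)
  have "\<bar>sgn (fst p - 1/2)\<bar> = 1"
    using assms(2) by (simp add: abs_sgn_eq)
  then have "slide p \<in> semicircle 0 \<alpha>"
    using \<alpha> False by (simp add: slide_def mem_semicircle_iff centre_def abs_mult)
  with N_0 \<alpha> show ?thesis
    by (rule same_semicircleI)
qed

lemma slide_mem_lower_half: "p \<in> knaster \<Longrightarrow> fst p \<noteq> 1/2 \<Longrightarrow> slide p \<in> lower_half"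
  using same_semicircle_imp_knaster[OF same_semicircle_slide]
  by (auto simp: lower_half_def slide_def)

lemma continuous_on_slide: "continuous_on {p. fst p \<noteq> 1/2} slide"
  unfolding slide_def
proof (rule continuous_on_cases_le)
  show "p = (1/2 + sgn (fst p - 1/2) * dist p (1/2, 0), 0)"
    if "snd p = 0" for p :: "real \<times> real"
    using that by (cases p) (simp add: sgn_mult_abs)
qed (auto intro!: continuous_intros)

section \<open>Path components\<close>

lemma semicircles_meet_imp_E0_star:
  assumes "\<alpha> \<in> N k" "p \<in> semicircle k \<alpha>" "\<beta> \<in> N j" "p \<in> semicircle j \<beta>"
  shows "E0_star \<alpha> \<beta>"
proof -
  have "\<exists>x. (x, 0) \<in> semicircle k \<alpha> \<and> (x, 0) \<in> semicircle j \<beta>"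
  proof (cases "snd p = 0")
    case True
    then show ?thesis using assms by (cases p) auto
  next
    case False
    then consider (upper) "k = 0" "j = 0" | (lower) "k \<ge> 1" "j \<ge> 1"
      using assms(2,4) by (fastforce simp: mem_semicircle_iff split: if_splits)
    then have "k = j"
    proof cases
      case lower
      have "p \<in> H_part k" "p \<in> H_part j"
        using assms by (auto simp: H_part_eq)
      with lower show ?thesis
        by (rule H_part_index_unique)
    qed simp
    then show ?thesis
      using assms(2,4) left_foot_mem_semicircle by blast
  qed
  then obtain x where "(x, 0) \<in> semicircle k \<alpha>" "(x, 0) \<in> semicircle j \<beta>"
    by blast
  then obtain \<gamma> \<delta> where "x = cantor_real \<gamma>" "E0_star \<alpha> \<gamma>" "x = cantor_real \<delta>" "E0_star \<beta> \<delta>"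
    using assms(1,3) by (metis semicircle_axisE)
  then show ?thesis
    using inj_cantor_real by (metis injD E0_star_sym E0_star_trans)
qed

definition label :: "real \<times> real \<Rightarrow> cantor" where
  "label p = (if 0 \<le> snd p then cantor_digits (left_foot 0 p) else cantor_digits (left_end p))"

lemma same_semicircle_label:
  assumes "p \<in> knaster"
  shows "same_semicircle p (cantor_point (label p))"
proof -
  define x where "x = (if 0 \<le> snd p then left_foot 0 p else left_end p)"
  have on_axis: "same_semicircle p (x, 0)"
    using assms same_semicircle_left_foot_0[of p] same_semicircle_left_end[of p]
    by (simp add: x_def upper_half_def lower_half_def)
  then have "x \<in> range cantor_real"
    by (intro knaster_axis same_semicircle_imp_knaster)
  then have "cantor_real (label p) = x"
    by (auto simp: label_def x_def split: if_splits)
  then show ?thesis using on_axis by simp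
qed

lemma E0_star_label:
  assumes "\<alpha> \<in> N k" "p \<in> semicircle k \<alpha>"
  shows "E0_star \<alpha> (label p)"
proof -
  have "p \<in> knaster"
    using assms by (auto simp: mem_knaster_iff)
  then obtain j \<beta> where \<beta>: "\<beta> \<in> N j" "p \<in> semicircle j \<beta>"
    "cantor_point (label p) \<in> semicircle j \<beta>"
    using same_semicircle_label unfolding same_semicircle_def by blast
  have "E0_star \<alpha> \<beta>"
    using assms \<beta>(1,2) by (rule semicircles_meet_imp_E0_star)
  also have "E0_star \<beta> (label p)"
    using \<beta>(1,3) N_0 cantor_point_mem_semicircle by (rule semicircles_meet_imp_E0_star)
  finally show ?thesis .
qed

lemma E0_star_label_cantor_point: "E0_star \<alpha> (label (cantor_point \<alpha>))"
  using N_0 cantor_point_mem_semicircle by (rule E0_star_label)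

lemma same_semicircle_imp_E0_star_label:
  assumes "same_semicircle p q"
  shows "E0_star (label p) (label q)"
proof -
  obtain k \<alpha> where "\<alpha> \<in> N k" "p \<in> semicircle k \<alpha>" "q \<in> semicircle k \<alpha>"
    using assms by (auto simp: same_semicircle_def)
  then show ?thesis
    using E0_star_label E0_star_sym E0_star_trans by blast
qed

lemma continuous_on_cantor_digits_knaster:
  assumes "continuous_on S f" "\<And>p. p \<in> S \<Longrightarrow> (f p, 0) \<in> knaster"
  shows "continuous_on S (\<lambda>p. cantor_digits (f p))"
  using assms knaster_axis by (intro continuous_on_compose2[OF continuous_on_cantor_digits]) auto

lemma continuous_on_upper_digits: "continuous_on upper_half (\<lambda>p. cantor_digits (left_foot 0 p))"
  using continuous_on_left_foot same_semicircle_imp_knaster[OF same_semicircle_left_foot_0]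
  by (rule continuous_on_cantor_digits_knaster)

lemma continuous_on_lower_digits: "continuous_on lower_half (\<lambda>p. cantor_digits (left_end p))"
  using continuous_on_left_end same_semicircle_imp_knaster[OF same_semicircle_left_end]
  by (rule continuous_on_cantor_digits_knaster)

lemma continuous_on_slide_digits:
  "continuous_on (knaster \<inter> {p. fst p \<noteq> 1/2}) (\<lambda>p. cantor_digits (left_end (slide p)))"
  using slide_mem_lower_half
  by (intro continuous_on_compose2[OF continuous_on_lower_digits]
      continuous_on_subset[OF continuous_on_slide]) auto

lemma E0_star_label_slide_digits:
  assumes "p \<in> knaster" "fst p \<noteq> 1/2"
  shows "E0_star (label p) (cantor_digits (left_end (slide p)))"
proof -
  have left_end: "same_semicircle (slide p) (left_end (slide p), 0)"
    using slide_mem_lower_half[OF assms] by (rule same_semicircle_left_end)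
  then obtain \<beta> where \<beta>: "left_end (slide p) = cantor_real \<beta>"
    using knaster_axis same_semicircle_imp_knaster by blast
  have "E0_star (label p) (label (slide p))"
    using same_semicircle_slide[OF assms] by (rule same_semicircle_imp_E0_star_label)
  also have "E0_star (label (slide p)) (label (cantor_point \<beta>))"
    using left_end unfolding \<beta> by (rule same_semicircle_imp_E0_star_label)
  also have "E0_star (label (cantor_point \<beta>)) \<beta>"
    using E0_star_label_cantor_point by (rule E0_star_sym)
  finally show ?thesis
    by (simp add: \<beta>)
qed

lemma knaster_label_chart:
  assumes "p \<in> knaster"
  shows "\<exists>W (g :: real \<times> real \<Rightarrow> cantor). open W \<and> p \<in> W \<and> continuous_on (knaster \<inter> W) g \<and>
    (\<forall>q\<in>knaster \<inter> W. E0_star (label q) (g q))"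
proof (cases "fst p = 1/2")
  case True
  show ?thesis
  proof (intro exI conjI ballI)
    show "open {q :: real \<times> real. 0 < snd q}"
      by (intro open_Collect_less continuous_intros)
    show "p \<in> {q. 0 < snd q}"
      using assms True lower_half_fst_neq_half[of p] by (force simp: lower_half_def)
    show "continuous_on (knaster \<inter> {q. 0 < snd q}) (\<lambda>q. cantor_digits (left_foot 0 q))"
      by (rule continuous_on_subset[OF continuous_on_upper_digits]) (auto simp: upper_half_def)
  qed (simp add: label_def E0_star_refl)
next
  case False
  show ?thesis
  proof (intro exI conjI ballI)
    show "open {q :: real \<times> real. fst q \<noteq> 1/2}"
      by (intro open_Collect_neq continuous_intros)
    show "continuous_on (knaster \<inter> {q. fst q \<noteq> 1/2}) (\<lambda>q. cantor_digits (left_end (slide q)))"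
      by (rule continuous_on_slide_digits)
  qed (use False E0_star_label_slide_digits in auto)
qed

lemma path_component_imp_E0_star_label:
  assumes "path_component knaster p q"
  shows "E0_star (label p) (label q)"
proof (rule path_component_imp_related[OF assms])
  show "equivp (\<lambda>p q. E0_star (label p) (label q))"
    using equivp_vimage2p[OF equivp_E0_star, of label] by (simp add: vimage2p_def)
next
  fix p assume "p \<in> knaster"
  from knaster_label_chart[OF this] obtain W and g :: "real \<times> real \<Rightarrow> cantor"
    where W: "open W" "p \<in> W" "continuous_on (knaster \<inter> W) g"
      and label_g: "\<And>q. q \<in> knaster \<inter> W \<Longrightarrow> E0_star (label q) (g q)"
    by blast
  have "E0_star (label q) (label r)"
    if "q \<in> knaster \<inter> W" "r \<in> knaster \<inter> W" "g q = g r" for q r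
    using E0_star_trans[OF label_g[OF that(1)]] E0_star_sym[OF label_g[OF that(2)]] that(3) by simp
  with W show "\<exists>W (g :: real \<times> real \<Rightarrow> cantor). open W \<and> p \<in> W \<and> continuous_on (knaster \<inter> W) g \<and>
      (\<forall>q\<in>knaster \<inter> W. \<forall>r\<in>knaster \<inter> W. g q = g r \<longrightarrow> E0_star (label q) (label r))"
    by blast
qed

section \<open>The reductions\<close>

lemma borel_measurable_label: "label \<in> borel_measurable (restrict_space borel knaster)"
  unfolding label_def
proof (rule borel_measurable_If_continuous_on)
  show "{p :: real \<times> real. 0 \<le> snd p} \<in> sets borel"
    by (intro borel_closed closed_Collect_le continuous_intros)
  show "continuous_on (knaster \<inter> {p. 0 \<le> snd p}) (\<lambda>p. cantor_digits (left_foot 0 p))"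
    using continuous_on_upper_digits by (simp add: upper_half_def)
  show "continuous_on (knaster \<inter> {p. \<not> 0 \<le> snd p}) (\<lambda>p. cantor_digits (left_end p))"
    by (rule continuous_on_subset[OF continuous_on_lower_digits]) (auto simp: lower_half_def)
qed

lemma borel_reducible_knaster_E0_star:
  "borel_reducible knaster (path_component knaster) UNIV E0_star"
  unfolding borel_reducible_def
proof (intro bexI ballI)
  fix p q assume "p \<in> knaster" "q \<in> knaster"
  then have axis: "path_component knaster p (cantor_point (label p))"
    "path_component knaster q (cantor_point (label q))"
    by (simp_all add: same_semicircle_label same_semicircle_imp_path_component)
  show "path_component knaster p q \<longleftrightarrow> E0_star (label p) (label q)"
  proof
    assume "E0_star (label p) (label q)"
    then have "path_component knaster (cantor_point (label p)) (cantor_point (label q))"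
      by (rule E0_star_imp_path_component)
    with axis show "path_component knaster p q"
      by (meson path_component_sym path_component_trans)
  qed (rule path_component_imp_E0_star_label)
next
  show "label \<in> restrict_space borel knaster \<rightarrow>\<^sub>M restrict_space borel UNIV"
    by (rule measurable_restrict_space2[OF _ borel_measurable_label]) simp
qed

lemma borel_reducible_E0_star_knaster:
  "borel_reducible UNIV E0_star knaster (path_component knaster)"
  unfolding borel_reducible_def
proof (intro bexI ballI)
  fix \<alpha> \<beta>
  show "E0_star \<alpha> \<beta> \<longleftrightarrow> path_component knaster (cantor_point \<alpha>) (cantor_point \<beta>)"
  proof
    assume path: "path_component knaster (cantor_point \<alpha>) (cantor_point \<beta>)"
    have "E0_star \<alpha> (label (cantor_point \<alpha>))"
      by (rule E0_star_label_cantor_point)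
    also have "E0_star (label (cantor_point \<alpha>)) (label (cantor_point \<beta>))"
      using path by (rule path_component_imp_E0_star_label)
    also have "E0_star (label (cantor_point \<beta>)) \<beta>"
      by (rule E0_star_sym) (rule E0_star_label_cantor_point)
    finally show "E0_star \<alpha> \<beta>" .
  qed (rule E0_star_imp_path_component)
next
  have "cantor_point \<in> borel_measurable borel"
    by (intro borel_measurable_continuous_onI continuous_intros continuous_on_cantor_real)
  then show "cantor_point \<in> restrict_space borel UNIV \<rightarrow>\<^sub>M restrict_space borel knaster"
    by (intro measurable_restrict_space1 measurable_restrict_space2)
      (simp_all add: cantor_point_mem_knaster)
qed

theorem theorem3p1:
  shows "borel_bireducible knaster (path_component knaster) UNIV E0_star"
  unfolding borel_bireducible_def
  using borel_reducible_knaster_E0_star borel_reducible_E0_star_knaster by (rule conjI)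

end
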